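(* Let $P=\{p_1,\ldots,p_n\}$ be a set of $n$ points on the real line and let $m<n/2$ be a positive integer. Then: (a) There exists a set $\mathcal{B}$ of $n-m$ $m$-restricted bicolorings of $P$ for which any geometric system of unbiased representatives (G-SUR) consisting of intervals has size at least $n-m$. (b) There exists a set $\mathcal{I}$ of $n-m$ intervals such that for any $m$-restricted bicoloring $B$ of $P$ there is at least one interval in $\mathcal{I}$ that is balanced with respect to $B$.
   Context: The points $p_1,\ldots,p_n$ are distinct and sorted from left to right. A bicoloring of $P$ is a map $B:P\to\{\text{Red},\text{Blue}\}$ that colors at least one point red and at least one point blue. A bicoloring is $m$-restricted if it has at least $m$ points of each color. An interval $I\subset\mathbb{R}$ is balanced with respect to $B$ if $I\cap P$ is nonempty and contains the same number of red and blue points with respect to $B$. Given a set $\mathcal{B}$ of bicolorings of $P$, a G-SUR for $\mathcal{B}$ consisting of intervals is a family $\mathcal{O}'$ of intervals such that for every $B\in\mathcal{B}$ at least one interval in $\mathcal{O}'$ is balanced with respect to $B$; its size is the number of intervals in $\mathcal{O}'$. *)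

theory Defs
  imports "HOL-Analysis.Analysis"
begin

datatype color = Red | Blue

text \<open>
  A bicoloring is a function with domain exactly \<open>P\<close>. The extensional function space makes
  two bicolorings equal iff they agree on \<open>P\<close>, so that sets of bicolorings have the intended
  cardinality.
\<close>

definition bicoloring :: "real set \<Rightarrow> (real \<Rightarrow> color) \<Rightarrow> bool" where
  "bicoloring P B \<longleftrightarrow>
     B \<in> P \<rightarrow>\<^sub>E UNIV \<and> (\<exists>x\<in>P. B x = Red) \<and> (\<exists>x\<in>P. B x = Blue)"

definition restricted_bicoloring :: "nat \<Rightarrow> real set \<Rightarrow> (real \<Rightarrow> color) \<Rightarrow> bool" where
  "restricted_bicoloring m P B \<longleftrightarrow>
     bicoloring P B \<and> card {x\<in>P. B x = Red} \<ge> m \<and> card {x\<in>P. B x = Blue} \<ge> m"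

definition balanced :: "real set \<Rightarrow> (real \<Rightarrow> color) \<Rightarrow> real set \<Rightarrow> bool" where
  "balanced P B I \<longleftrightarrow>
     I \<inter> P \<noteq> {} \<and> card {x \<in> I \<inter> P. B x = Red} = card {x \<in> I \<inter> P. B x = Blue}"

definition interval_gsur :: "real set \<Rightarrow> (real \<Rightarrow> color) set \<Rightarrow> real set set \<Rightarrow> bool" where
  "interval_gsur P \<B> \<O> \<longleftrightarrow>
     (\<forall>I\<in>\<O>. is_interval I) \<and> (\<forall>B\<in>\<B>. \<exists>I\<in>\<O>. balanced P B I)"

end

theory Submission
  imports Defs
begin

text \<open>
  Part (b): if the \<open>n - m\<close> intervals \<open>[p\<^sub>i, p\<^sub>i\<^sub>+\<^sub>1]\<close> with \<open>i \<le> n - m\<close> are all unbalanced, then the first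
  \<open>n - m + 1\<close> points have the same color, which leaves fewer than \<open>m\<close> points of the other color.

  Part (a): for \<open>1 \<le> k \<le> n - m\<close> color the points \<open>p\<^sub>k\<^sub>+\<^sub>1, \<dots>, p\<^sub>k\<^sub>+\<^sub>n\<^sub>-\<^sub>m\<close> (as far as they exist) blue and
  the others red. An interval that meets red points on both sides of the blue block contains
  \<open>n - m > m\<close> blue and at most \<open>m\<close> red points, so a balanced interval is centered at one of the two
  ends \<open>k\<close> and \<open>k + n - m\<close> of the block. These ends are different for different \<open>k\<close>, so no
  interval is balanced for two of these colorings.

  The points are numbered from 1 here and from 0 in the formal text.
\<close>

lemma unbalanced_points_imp_same_color:
  assumes "I \<inter> P = {x, y}" "\<not> balanced P B I"
  shows "B x = B y"
proof (rule ccontr)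
  assume ne: "B x \<noteq> B y"
  have "{z \<in> I \<inter> P. B z = Red} = (if B x = Red then {x} else {y})"
    and "{z \<in> I \<inter> P. B z = Blue} = (if B x = Red then {y} else {x})"
    using assms(1) ne by (cases "B x"; cases "B y"; auto)+
  then have "balanced P B I"
    using assms(1) by (auto simp: balanced_def)
  with assms(2) show False by blast
qed

locale point_enumeration =
  fixes P :: "real set" and n m :: nat and p :: "nat \<Rightarrow> real"
  assumes bij: "bij_betw p {..<n} P" and mono: "strict_mono_on {..<n} p"
    and m_pos: "0 < m" and m_less: "2 * m < n"
begin

lemma p_less_iff: "i < n \<Longrightarrow> j < n \<Longrightarrow> p i < p j \<longleftrightarrow> i < j"
  using mono by (meson lessThan_iff strict_mono_on_less)

lemma p_le_iff: "i < n \<Longrightarrow> j < n \<Longrightarrow> p i \<le> p j \<longleftrightarrow> i \<le> j"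
  using p_less_iff by (meson not_less)

lemma p_eq_iff: "i < n \<Longrightarrow> j < n \<Longrightarrow> p i = p j \<longleftrightarrow> i = j"
  using p_le_iff by (metis order_antisym order_refl)

lemma p_in: "i < n \<Longrightarrow> p i \<in> P"
  using bij by (auto simp: bij_betw_def)

lemma P_eq: "P = p ` {..<n}"
  using bij by (auto simp: bij_betw_def)

text \<open>Turns color counts into counts of indices, where the color classes become ranges of
  natural numbers.\<close>

lemma card_Collect_index: "card {x \<in> P. Q x} = card {i. i < n \<and> Q (p i)}"
proof -
  have "{x \<in> P. Q x} = p ` {i. i < n \<and> Q (p i)}"
    unfolding P_eq by auto
  moreover have "inj_on p {i. i < n \<and> Q (p i)}"
    using p_eq_iff by (auto simp: inj_on_def)
  ultimately show ?thesis by (simp add: card_image)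
qed

text \<open>By convexity, \<open>I\<close> contains every point between its leftmost and its
  rightmost point of \<open>P\<close>. With a half-open index range, \<open>a + b\<close> is twice
  the position of its center, measured in gaps between points.\<close>

lemma interval_indices:
  assumes I: "is_interval I" and ne: "I \<inter> P \<noteq> {}"
  obtains a b where "a < b" "b \<le> n" "\<And>i. i < n \<Longrightarrow> p i \<in> I \<longleftrightarrow> a \<le> i \<and> i < b"
proof -
  define T where "T = {i. i < n \<and> p i \<in> I}"
  have T: "finite T" "T \<noteq> {}"
    using ne by (auto simp: T_def P_eq)
  note mem = Min_in[OF T] Max_in[OF T]
  show thesis
  proof
    show "Min T < Suc (Max T)" using T by (simp add: le_imp_less_Suc)
    show "Suc (Max T) \<le> n" using mem by (auto simp: T_def)
    fix i assume i: "i < n"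
    show "p i \<in> I \<longleftrightarrow> Min T \<le> i \<and> i < Suc (Max T)"
    proof
      assume "p i \<in> I"
      then have "i \<in> T" using i by (simp add: T_def)
      then show "Min T \<le> i \<and> i < Suc (Max T)" using T by (simp add: le_imp_less_Suc)
    next
      assume "Min T \<le> i \<and> i < Suc (Max T)"
      then have "p (Min T) \<le> p i" "p i \<le> p (Max T)"
        using mem i by (auto simp: T_def p_le_iff)
      moreover have "p (Min T) \<in> I" "p (Max T) \<in> I" using mem by (auto simp: T_def)
      ultimately show "p i \<in> I" using I unfolding is_interval_1 by blast
    qed
  qed
qed

definition adjacent_intervals :: "real set set" where
  "adjacent_intervals = (\<lambda>i. {p i..p (Suc i)}) ` {..<n - m}"

lemma card_adjacent_intervals: "card adjacent_intervals = n - m"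
proof -
  have "inj_on (\<lambda>i. {p i..p (Suc i)}) {..<n - m}"
  proof (rule inj_onI)
    fix i j assume ij: "i \<in> {..<n - m}" "j \<in> {..<n - m}" "{p i..p (Suc i)} = {p j..p (Suc j)}"
    moreover have "p i \<le> p (Suc i)" "p j \<le> p (Suc j)"
      \<comment> \<open>As \<open>m\<close> is positive, \<open>Suc i \<le> n - m < n\<close>, so
        the right endpoint is a point of \<open>P\<close>.\<close>
      using ij m_pos by (auto simp: p_le_iff)
    ultimately have "p i = p j" by (simp add: Icc_eq_Icc)
    then show "i = j" using ij by (simp add: p_eq_iff)
  qed
  then show ?thesis by (simp add: adjacent_intervals_def card_image)
qed

lemma adjacent_interval_balanced:
  assumes B: "restricted_bicoloring m P B"
  shows "\<exists>I\<in>adjacent_intervals. balanced P B I"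
proof (rule ccontr)
  assume unbal: "\<not> ?thesis"
  have step: "B (p i) = B (p (Suc i))" if "i < n - m" for i
  proof (rule unbalanced_points_imp_same_color)
    show "{p i..p (Suc i)} \<inter> P = {p i, p (Suc i)}"
      using that m_pos by (auto simp: P_eq p_le_iff le_Suc_eq)
    show "\<not> balanced P B {p i..p (Suc i)}"
      using unbal that by (auto simp: adjacent_intervals_def)
  qed
  have same: "B (p i) = B (p 0)" if "i \<le> n - m" for i
    using that by (induction i) (simp_all add: step[symmetric])
  \<comment> \<open>A color other than that of the first point can only occur at the
    \<open>m - 1\<close> indices beyond \<open>n - m\<close>.\<close>
  have few: "card {x \<in> P. B x = c} < m" if "c \<noteq> B (p 0)" for c
  proof -
    have "{i. i < n \<and> B (p i) = c} \<subseteq> {n - m<..<n}"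
    proof
      fix i assume i: "i \<in> {i. i < n \<and> B (p i) = c}"
      then have "\<not> i \<le> n - m" using same that by blast
      then show "i \<in> {n - m<..<n}" using i by simp
    qed
    then have "card {i. i < n \<and> B (p i) = c} \<le> card {n - m<..<n}"
      by (intro card_mono) auto
    then show ?thesis
      using m_pos m_less by (simp add: card_Collect_index)
  qed
  show False
    using few[of Red] few[of Blue] B
    by (cases "B (p 0)") (auto simp: restricted_bicoloring_def)
qed

text \<open>Exactly \<open>k\<close> points precede the block when \<open>k < n\<close>; its right
  end may exceed \<open>n\<close>. Restricting to \<open>P\<close> gives the extensional function
  that \<open>bicoloring\<close> demands.\<close>

definition blue_block_coloring :: "nat \<Rightarrow> real \<Rightarrow> color" where
  "blue_block_coloring k =
     (\<lambda>x\<in>P. if the_inv_into {..<n} p x \<in> {k..<k + (n - m)} then Blue else Red)"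

lemma blue_block_coloring_p:
  assumes "i < n"
  shows "blue_block_coloring k (p i) = (if k \<le> i \<and> i < k + (n - m) then Blue else Red)"
proof -
  have "the_inv_into {..<n} p (p i) = i"
    using assms bij by (auto simp: bij_betw_def intro: the_inv_into_f_f)
  then show ?thesis using assms by (simp add: blue_block_coloring_def p_in)
qed

text \<open>There are \<open>max k m\<close> red points: \<open>k\<close> before the block and, if
  \<open>k < m\<close>, another \<open>m - k\<close> after it. The blue points number
  \<open>min (n - m) (n - k)\<close>, which is at least \<open>m\<close>.\<close>

lemma restricted_bicoloring_blue_block:
  assumes k: "k \<in> {1..n - m}"
  shows "restricted_bicoloring m P (blue_block_coloring k)"
proof -
  have "{i. i < n \<and> blue_block_coloring k (p i) = Red} = {..<k} \<union> {k + (n - m)..<n}"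
    using k by (auto simp: blue_block_coloring_p split: if_splits)
  moreover have "card ({..<k} \<union> {k + (n - m)..<n}) = k + (n - (k + (n - m)))"
    by (subst card_Un_disjoint) auto
  ultimately have red: "card {x \<in> P. blue_block_coloring k x = Red} \<ge> m"
    using m_less by (simp add: card_Collect_index)
  have "{i. i < n \<and> blue_block_coloring k (p i) = Blue} = {k..<min n (k + (n - m))}"
    by (auto simp: blue_block_coloring_p split: if_splits)
  then have "card {x \<in> P. blue_block_coloring k x = Blue} = min n (k + (n - m)) - k"
    unfolding card_Collect_index by (simp only: card_atLeastLessThan)
  moreover have "m \<le> min n (k + (n - m)) - k"
    using k m_less by (auto simp: min_def)
  ultimately have blue: "card {x \<in> P. blue_block_coloring k x = Blue} \<ge> m"
    by (simp only:)
  have "{x \<in> P. blue_block_coloring k x = Red} \<noteq> {}"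
    using red m_pos by (intro notI) simp
  moreover have "{x \<in> P. blue_block_coloring k x = Blue} \<noteq> {}"
    using blue m_pos by (intro notI) simp
  moreover have "blue_block_coloring k \<in> P \<rightarrow>\<^sub>E UNIV"
    by (simp add: blue_block_coloring_def)
  ultimately show ?thesis
    using red blue by (auto simp: restricted_bicoloring_def bicoloring_def)
qed

text \<open>Meeting one color only excludes balance. If \<open>I\<close> crosses just one end of the
  block, equal counts on both sides of that end make it the center. If \<open>I\<close> crosses both
  ends, it has \<open>n - m\<close> blue points against at most \<open>m\<close> red ones.\<close>

lemma balanced_blue_block_center:
  assumes k: "k \<in> {1..n - m}" and ab: "a < b" "b \<le> n"
    and I: "\<And>i. i < n \<Longrightarrow> p i \<in> I \<longleftrightarrow> a \<le> i \<and> i < b"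
    and bal: "balanced P (blue_block_coloring k) I"
  shows "a + b = 2 * k \<or> a + b = 2 * (k + (n - m))"
proof -
  let ?q = "k + (n - m)"
  have "{i. i < n \<and> p i \<in> I \<and> blue_block_coloring k (p i) = Red}
      = {a..<min b k} \<union> {max a ?q..<b}"
    using ab I by (auto simp: blue_block_coloring_p split: if_splits)
  moreover have "card ({a..<min b k} \<union> {max a ?q..<b}) = (min b k - a) + (b - max a ?q)"
    by (subst card_Un_disjoint) auto
  moreover have "{i. i < n \<and> p i \<in> I \<and> blue_block_coloring k (p i) = Blue}
      = {max a k..<min b ?q}"
    using ab I by (auto simp: blue_block_coloring_p split: if_splits)
  moreover have "{x \<in> I \<inter> P. blue_block_coloring k x = c}
      = {x \<in> P. x \<in> I \<and> blue_block_coloring k x = c}" for c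
    by auto
  \<comment> \<open>Truncated subtraction yields 0 for each range that \<open>I\<close> misses, so
    one equation covers all positions of \<open>I\<close>.\<close>
  ultimately have "(min b k - a) + (b - max a ?q) = min b ?q - max a k"
    using bal by (simp add: balanced_def card_Collect_index)
  then show ?thesis
    using k ab m_less by (auto simp: min_def max_def split: if_splits)
qed

text \<open>The center determines the block: left ends are at most \<open>n - m\<close>, right ends
  exceed \<open>n - m\<close>, and ends of the same kind differ for different
  \<open>k\<close>.\<close>

lemma balanced_blue_block_unique:
  assumes "k \<in> {1..n - m}" "l \<in> {1..n - m}" and I: "is_interval I"
    and k: "balanced P (blue_block_coloring k) I" and l: "balanced P (blue_block_coloring l) I"
  shows "k = l"
proof -
  have "I \<inter> P \<noteq> {}" using k by (simp add: balanced_def)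
  with I obtain a b where ab: "a < b" "b \<le> n" "\<And>i. i < n \<Longrightarrow> p i \<in> I \<longleftrightarrow> a \<le> i \<and> i < b"
    by (rule interval_indices) blast
  show ?thesis
    using balanced_blue_block_center[OF assms(1) ab k] balanced_blue_block_center[OF assms(2) ab l]
      assms(1,2) by auto
qed

lemma inj_on_blue_block_coloring: "inj_on blue_block_coloring {1..n - m}"
proof -
  have ne: "blue_block_coloring k \<noteq> blue_block_coloring l"
    if "k < l" "l \<in> {1..n - m}" for k l
  proof -
    \<comment> \<open>The first point of the earlier block still lies before the later one.\<close>
    have "blue_block_coloring k (p k) = Blue" "blue_block_coloring l (p k) = Red"
      using that m_less by (auto simp: blue_block_coloring_p)
    then show ?thesis by auto
  qed
  show ?thesis
    by (rule inj_onI) (metis ne linorder_neqE_nat)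
qed

text \<open>Choosing a balanced interval for each coloring is injective, as no interval serves two
  of them. Finiteness matters because \<open>card\<close> is 0 on infinite sets.\<close>

lemma card_gsur_blue_block:
  assumes \<O>: "interval_gsur P (blue_block_coloring ` {1..n - m}) \<O>" and fin: "finite \<O>"
  shows "n - m \<le> card \<O>"
proof -
  have "\<forall>k\<in>{1..n - m}. \<exists>I. I \<in> \<O> \<and> balanced P (blue_block_coloring k) I"
    using \<O> by (auto simp: interval_gsur_def)
  from bchoice[OF this] obtain f
    where f: "\<And>k. k \<in> {1..n - m} \<Longrightarrow> f k \<in> \<O> \<and> balanced P (blue_block_coloring k) (f k)"
    by blast
  have "inj_on f {1..n - m}"
  proof (rule inj_onI)
    fix k l assume kl: "k \<in> {1..n - m}" "l \<in> {1..n - m}" "f k = f l"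
    have "is_interval (f k)" using f[OF kl(1)] \<O> by (simp add: interval_gsur_def)
    then show "k = l" using balanced_blue_block_unique f kl by metis
  qed
  moreover have "f ` {1..n - m} \<subseteq> \<O>" using f by auto
  ultimately show ?thesis using card_inj_on_le[of f "{1..n - m}" \<O>] fin by simp
qed

end

theorem theorem3:
  fixes P :: "real set" and n m :: nat
  assumes "finite P" and "card P = n"
    and "0 < m" and "real m < real n / 2"
  shows "(\<exists>\<B>. card \<B> = n - m \<and> (\<forall>B\<in>\<B>. restricted_bicoloring m P B) \<and>
            (\<forall>\<O>. interval_gsur P \<B> \<O> \<longrightarrow> infinite \<O> \<or> n - m \<le> card \<O>)) \<and>
         (\<exists>\<I>. card \<I> = n - m \<and> (\<forall>I\<in>\<I>. is_interval I) \<and>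
            (\<forall>B. restricted_bicoloring m P B \<longrightarrow> (\<exists>I\<in>\<I>. balanced P B I)))"
proof -
  have "bij_betw ((!) (sorted_list_of_set P)) {..<n} P"
    using assms(1,2) by (intro bij_betw_nth) auto
  moreover have "strict_mono_on {..<n} ((!) (sorted_list_of_set P))"
    using assms(2) by (auto intro!: strict_mono_onI simp: sorted_wrt_nth_less)
  ultimately interpret point_enumeration P n m "(!) (sorted_list_of_set P)"
    using assms by unfold_locales auto
  show ?thesis
  proof (intro conjI exI[of _ "blue_block_coloring ` {1..n - m}"] exI[of _ adjacent_intervals])
    show "card (blue_block_coloring ` {1..n - m}) = n - m"
      using inj_on_blue_block_coloring by (simp add: card_image)
    show "\<forall>B\<in>blue_block_coloring ` {1..n - m}. restricted_bicoloring m P B"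
      using restricted_bicoloring_blue_block by blast
    show "\<forall>\<O>. interval_gsur P (blue_block_coloring ` {1..n - m}) \<O> \<longrightarrow> infinite \<O> \<or> n - m \<le> card \<O>"
      using card_gsur_blue_block by blast
    show "card adjacent_intervals = n - m"
      by (rule card_adjacent_intervals)
    show "\<forall>I\<in>adjacent_intervals. is_interval I"
      by (auto simp: adjacent_intervals_def is_interval_cc)
    show "\<forall>B. restricted_bicoloring m P B \<longrightarrow> (\<exists>I\<in>adjacent_intervals. balanced P B I)"
      using adjacent_interval_balanced by blast
  qed
qed

end
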